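(* Let $G$ be a finite group and $A \le \mathrm{Aut}(G)$. If the center $Z(G)$ is not a $p$-group for any prime $p$, then the graph $\Delta(G,A)$ is connected, and moreover $\mathrm{diam}(\Delta(G,A)) \le 4$.
   Context: For a finite group $G$ and a subgroup $A \le \mathrm{Aut}(G)$, write $g^A = \{g^a \mid a \in A\}$ for the $A$-orbit of $g \in G$. The automorphic cyclic graph $\Delta(G,A)$ is the simple graph with vertex set $\{g^A : 1 \ne g \in G\}$, in which two distinct vertices $x^A, y^A$ are joined by an edge if there exist $x' \in x^A$ and $y' \in y^A$ such that $\langle x', y' \rangle$ is cyclic. *)

theory Defs
  imports
    "HOL-Algebra.Bij"
    "HOL-Algebra.Elementary_Groups"
    "HOL-Algebra.Group_Action"
    "HOL-Computational_Algebra.Primes"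
    "Graph_Theory.Graph_Theory"
begin

definition center :: "('a, 'b) monoid_scheme \<Rightarrow> 'a set" where
  "center G = {z \<in> carrier G. \<forall>g \<in> carrier G. z \<otimes>\<^bsub>G\<^esub> g = g \<otimes>\<^bsub>G\<^esub> z}"

text \<open>Only for finite groups. The trivial group is a \<open>p\<close>-group for every \<open>p\<close> (case \<open>n = 0\<close>).\<close>

definition is_p_group :: "nat \<Rightarrow> ('a, 'b) monoid_scheme \<Rightarrow> bool" where
  "is_p_group p H \<longleftrightarrow> group H \<and> (\<exists>n. order H = p ^ n)"

text \<open>Here \<open>A\<close> is the underlying set of a subgroup of \<open>AutoGroup G\<close>; it acts by evaluation.\<close>

definition aut_orbit :: "('a, 'b) monoid_scheme \<Rightarrow> ('a \<Rightarrow> 'a) set \<Rightarrow> 'a \<Rightarrow> 'a set" where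
  "aut_orbit G A g = Group_Action.orbit (AutoGroup G\<lparr>carrier := A\<rparr>) (\<lambda>a. a) g"

lemma aut_orbit_eq: "aut_orbit G A g = {a g | a. a \<in> A}"
  by (simp add: aut_orbit_def Group_Action.orbit_def)

text \<open>Simple graphs are loopfree symmetric digraphs without multiple arcs: an edge between
  \<open>X\<close> and \<open>Y\<close> is the pair of arcs \<open>(X, Y)\<close>, \<open>(Y, X)\<close>.\<close>

definition aut_cyclic_verts :: "('a, 'b) monoid_scheme \<Rightarrow> ('a \<Rightarrow> 'a) set \<Rightarrow> 'a set set" where
  "aut_cyclic_verts G A = {aut_orbit G A g | g. g \<in> carrier G \<and> g \<noteq> \<one>\<^bsub>G\<^esub>}"

definition aut_cyclic_graph ::
    "('a, 'b) monoid_scheme \<Rightarrow> ('a \<Rightarrow> 'a) set \<Rightarrow> ('a set, 'a set \<times> 'a set) pre_digraph" where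
  "aut_cyclic_graph G A =
    \<lparr>verts = aut_cyclic_verts G A,
     arcs = {(X, Y). X \<in> aut_cyclic_verts G A \<and> Y \<in> aut_cyclic_verts G A \<and> X \<noteq> Y \<and>
                     (\<exists>x' \<in> X. \<exists>y' \<in> Y. cyclic_group (subgroup_generated G {x', y'}))},
     tail = fst,
     head = snd\<rparr>"

lemma graph_aut_cyclic_graph:
  assumes "finite (carrier G)"
  shows "graph (aut_cyclic_graph G A)"
proof -
  have fin: "finite (aut_cyclic_verts G A)"
    using assms by (simp add: aut_cyclic_verts_def)
  have "finite (arcs (aut_cyclic_graph G A))"
    by (rule finite_subset[of _ "aut_cyclic_verts G A \<times> aut_cyclic_verts G A"])
      (auto simp: aut_cyclic_graph_def fin)
  moreover have "symmetric (aut_cyclic_graph G A)"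
  proof -
    have "cyclic_group (subgroup_generated G {x, y}) \<longleftrightarrow>
          cyclic_group (subgroup_generated G {y, x})" for x y
      by (simp add: insert_commute)
    then show ?thesis
      by (fastforce simp: symmetric_conv aut_cyclic_graph_def)
  qed
  ultimately show ?thesis
    using fin by unfold_locales (auto simp: aut_cyclic_graph_def arc_to_ends_def)
qed

text \<open>With unit weights, \<open>wf_digraph.\<mu>\<close> is the usual distance, the infimum of the
  lengths of the walks from \<open>u\<close> to \<open>v\<close>, which is \<open>\<infinity>\<close> if there are none.\<close>

definition graph_diameter :: "('v, 'e) pre_digraph \<Rightarrow> ereal" where
  "graph_diameter D = (SUP (u, v) \<in> verts D \<times> verts D. wf_digraph.\<mu> D (\<lambda>_. 1) u v)"

end

theory Submission
  imports Defs "HOL-Algebra.Multiplicative_Group" "HOL-Algebra.Sylow"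
begin

text \<open>Since \<open>|Z(G)|\<close> is not a prime power, the center contains elements \<open>c\<close>, \<open>d\<close> of distinct
  prime orders \<open>p\<close>, \<open>q\<close>. Every vertex has distance at most 2 from the orbit of \<open>c\<close>: a
  \<open>p\<close>-element reaches \<open>c\<close> through \<open>d\<close>, and any other element through one of its powers of
  prime order different from \<open>p\<close>, because commuting elements of coprime orders generate a
  cyclic group.\<close>

section \<open>Prime divisors and elements of prime order\<close>

lemma exists_other_prime_divisor:
  fixes n p :: nat
  assumes "n > 0" and "\<And>k. n \<noteq> p ^ k"
  obtains r where "prime r" "r \<noteq> p" "r dvd n"
proof (rule ccontr)
  assume "\<not> thesis"
  then have only: "r = p" if "r \<in> prime_factors n" for r
    using that \<open>n > 0\<close> \<open>\<And>r. prime r \<Longrightarrow> r \<noteq> p \<Longrightarrow> r dvd n \<Longrightarrow> thesis\<close> by auto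
  \<comment> \<open>All prime factors being \<open>p\<close>, the factorization consists of copies
    of \<open>p\<close>, possibly none, so \<open>n\<close> is a power of \<open>p\<close>.\<close>
  have "n = prod_mset (prime_factorization n)"
    using \<open>n > 0\<close> by (simp add: prod_mset_prime_factorization_nat)
  also have "prime_factorization n = replicate_mset (size (prime_factorization n)) p"
    using only by (intro set_mset_subset_singletonD) auto
  finally show False
    using assms(2) by (metis prod_mset_replicate_mset)
qed

text \<open>Powers in a subgroup are powers in \<open>G\<close>. This brings orders found inside a
  Sylow subgroup or the center back to \<open>G\<close>.\<close>

lemma (in group) ord_restrict_carrier:
  assumes "subgroup H G" and "x \<in> H"
  shows "group.ord (G\<lparr>carrier := H\<rparr>) x = ord x"
proof -
  interpret H: group "G\<lparr>carrier := H\<rparr>"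
    using assms(1) by (rule subgroup_imp_group)
  have "x \<in> carrier G"
    using assms by (rule subgroup.mem_carrier)
  then show ?thesis
    using H.ord_unique[of x "ord x"] assms(2) pow_eq_id[of x]
    by (simp flip: nat_pow_consistent)
qed

text \<open>Sylow's theorem with exponent 1 gives a subgroup of order \<open>p\<close>. A nontrivial
  element of it has order dividing \<open>p\<close> and different from 1.\<close>

lemma (in group) cauchy_prime_order:
  assumes "finite (carrier G)" and "prime p" and "p dvd order G"
  obtains x where "x \<in> carrier G" "ord x = p"
proof -
  obtain m where "order G = p ^ 1 * m"
    using assms(3) by auto
  then obtain H where H: "subgroup H G" "card H = p"
    using sylow_thm[OF assms(2) is_group _ assms(1)] by (metis power_one_right)
  have "\<exists>x\<in>H. x \<noteq> \<one>"
  proof (rule ccontr)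
    assume "\<not> (\<exists>x\<in>H. x \<noteq> \<one>)"
    then have "H \<subseteq> {\<one>}"
      by auto
    then have "card H \<le> 1"
      using card_mono[of "{\<one>}" H] by simp
    then show False
      using H(2) prime_gt_1_nat[OF assms(2)] by simp
  qed
  then obtain x where x: "x \<in> H" "x \<noteq> \<one>"
    by blast
  interpret H: group "G\<lparr>carrier := H\<rparr>"
    using H(1) by (rule subgroup_imp_group)
  have xG: "x \<in> carrier G"
    using H(1) x(1) by (rule subgroup.mem_carrier)
  have "ord x dvd p"
    using H.ord_dvd_group_order[of x] x(1) H by (simp add: ord_restrict_carrier order_def)
  moreover have "ord x \<noteq> 1"
    using xG x(2) ord_eq_1 by blast
  ultimately have "ord x = p"
    using assms(2) prime_nat_iff by blast
  with xG show thesis ..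
qed

section \<open>Cyclic subgroups generated by two elements\<close>

lemma (in group) cyclic_group_generated_pair:
  assumes "x \<in> carrier G" "y \<in> carrier G"
    and "g \<in> generate G {x, y}" and "x \<in> generate G {g}" "y \<in> generate G {g}"
  shows "cyclic_group (subgroup_generated G {x, y})"
proof -
  have sub: "{x, y} \<subseteq> carrier G"
    using assms by simp
  have gG: "g \<in> carrier G"
    using generate_in_carrier[OF sub assms(3)] .
  have "generate G {x, y} = generate G {g}"
  proof
    show "generate G {x, y} \<subseteq> generate G {g}"
      using assms gG by (intro generate_subgroup_incl generate_is_subgroup) auto
    show "generate G {g} \<subseteq> generate G {x, y}"
      using assms sub by (intro generate_subgroup_incl generate_is_subgroup) auto
  qed
  \<comment> \<open>\<open>subgroup_generated\<close> first intersects its generators with the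
    carrier, which changes nothing here.\<close>
  then have "subgroup_generated G {x, y} = subgroup_generated G {g}"
    using sub gG by (simp add: subgroup_generated_def Int_absorb1)
  then show ?thesis
    by (simp add: cyclic_group_generated)
qed

lemma (in group) cyclic_group_generated_pow:
  fixes k :: nat
  assumes "x \<in> carrier G"
  shows "cyclic_group (subgroup_generated G {x, x [^] k})"
proof (rule cyclic_group_generated_pair)
  \<comment> \<open>This goal fixes the schematic generator of the rule as \<open>x\<close>.\<close>
  show "x [^] k \<in> generate G {x}"
    using generate_pow[OF assms] by (auto simp flip: int_pow_int)
qed (use assms in \<open>auto intro: generate.incl\<close>)

text \<open>The product of \<open>x\<close> and \<open>y\<close> is a generator: Bezout coefficients
  for the two orders give exponents that recover each factor from it.\<close>

lemma (in group) cyclic_group_generated_coprime_ord: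
  assumes xy: "x \<in> carrier G" "y \<in> carrier G"
    and comm: "x \<otimes> y = y \<otimes> x" and cop: "coprime (ord x) (ord y)"
  shows "cyclic_group (subgroup_generated G {x, y})"
proof -
  obtain u v :: int where bez: "u * int (ord x) + v * int (ord y) = 1"
    using bezout_int[of "int (ord x)" "int (ord y)"] cop by auto
  \<comment> \<open>The exponent is 0 modulo \<open>ord y\<close> and 1 modulo \<open>ord x\<close>,
    so it kills \<open>y\<close> and fixes \<open>x\<close>.\<close>
  have "(x \<otimes> y) [^] (v * int (ord y)) = x [^] (v * int (ord y)) \<otimes> y [^] (v * int (ord y))"
    using comm xy by (rule int_pow_mult_distrib)
  also have "y [^] (v * int (ord y)) = \<one>"
    using xy by (simp add: int_pow_eq_id)
  also have "x [^] (v * int (ord y)) = x [^] (1::int)"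
    using bez xy by (subst int_pow_eq) (auto simp: algebra_simps intro!: dvdI[of _ _ u])
  finally have x: "x = (x \<otimes> y) [^] (v * int (ord y))"
    using xy by simp
  have "(x \<otimes> y) [^] (u * int (ord x)) = x [^] (u * int (ord x)) \<otimes> y [^] (u * int (ord x))"
    using comm xy by (rule int_pow_mult_distrib)
  also have "x [^] (u * int (ord x)) = \<one>"
    using xy by (simp add: int_pow_eq_id)
  also have "y [^] (u * int (ord x)) = y [^] (1::int)"
    using bez xy by (subst int_pow_eq) (auto simp: algebra_simps intro!: dvdI[of _ _ v])
  finally have y: "y = (x \<otimes> y) [^] (u * int (ord x))"
    using xy by simp
  show ?thesis
  proof (rule cyclic_group_generated_pair[OF xy])
    show "x \<otimes> y \<in> generate G {x, y}"
      by (simp add: generate.eng generate.incl)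
    show "x \<in> generate G {x \<otimes> y}" "y \<in> generate G {x \<otimes> y}"
      using x y generate_pow[of "x \<otimes> y"] xy by auto
  qed
qed

section \<open>Central elements and links to them\<close>

lemma (in group) center_subgroup: "subgroup (center G) G"
proof (rule subgroupI)
  show "center G \<noteq> {}"
    by (auto simp: center_def intro!: exI[of _ \<one>])
next
  fix a assume a: "a \<in> center G"
  show "inv a \<in> center G"
  proof -
    have aG: "a \<in> carrier G" and c: "\<And>g. g \<in> carrier G \<Longrightarrow> a \<otimes> g = g \<otimes> a"
      using a by (auto simp: center_def)
    have "inv a \<otimes> g = g \<otimes> inv a" if g: "g \<in> carrier G" for g
    proof -
      have "a \<otimes> (g \<otimes> inv a) = g \<otimes> (a \<otimes> inv a)"
        using aG g c[OF g] by (metis inv_closed m_assoc)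
      then have "a \<otimes> (g \<otimes> inv a) = g"
        using aG g by simp
      then show ?thesis
        using aG g by (metis inv_closed inv_solve_left m_closed)
    qed
    then show ?thesis
      using aG by (simp add: center_def)
  qed
next
  fix a b assume "a \<in> center G" "b \<in> center G"
  then have ab: "a \<in> carrier G" "b \<in> carrier G"
    and c: "\<And>g. g \<in> carrier G \<Longrightarrow> a \<otimes> g = g \<otimes> a" "\<And>g. g \<in> carrier G \<Longrightarrow> b \<otimes> g = g \<otimes> b"
    by (auto simp: center_def)
  have "a \<otimes> b \<otimes> g = g \<otimes> (a \<otimes> b)" if "g \<in> carrier G" for g
    using ab c that by (metis m_assoc)
  then show "a \<otimes> b \<in> center G"
    using ab by (simp add: center_def)
qed (auto simp: center_def)

text \<open>Cauchy's theorem is applied to the center as a group of its own; the order found there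
  is the order in \<open>G\<close>.\<close>

lemma (in group) center_cauchy:
  assumes "finite (carrier G)" and "prime p" and "p dvd card (center G)"
  obtains z where "z \<in> center G" "ord z = p"
proof -
  interpret Z: group "G\<lparr>carrier := center G\<rparr>"
    by (rule subgroup_imp_group[OF center_subgroup])
  have "finite (center G)"
    using assms(1) by (auto simp: center_def)
  then obtain z where "z \<in> center G" "Z.ord z = p"
    using Z.cauchy_prime_order[of p] assms by (auto simp: order_def)
  then show thesis
    using that by (simp add: ord_restrict_carrier[OF center_subgroup])
qed

text \<open>This is the two-step path to the orbit of \<open>c\<close>, stated for elements:
  \<open>w\<close> is \<open>d\<close> if \<open>ord x\<close> is a power of \<open>p\<close>, and
  otherwise a power of \<open>x\<close>.\<close>

lemma (in group) cyclic_link_to_central_element: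
  assumes fin: "finite (carrier G)" and "prime p" "prime q" "p \<noteq> q"
    and c: "c \<in> center G" "ord c = p" and d: "d \<in> center G" "ord d = q"
    and x: "x \<in> carrier G"
  obtains w where "w \<in> carrier G" "w \<noteq> \<one>"
    "cyclic_group (subgroup_generated G {x, w})" "cyclic_group (subgroup_generated G {w, c})"
proof -
  have cG: "c \<in> carrier G" "\<And>g. g \<in> carrier G \<Longrightarrow> g \<otimes> c = c \<otimes> g"
    and dG: "d \<in> carrier G" "\<And>g. g \<in> carrier G \<Longrightarrow> g \<otimes> d = d \<otimes> g"
    using c d by (auto simp: center_def)
  have cop: "coprime q p"
    using assms(2-4) by (simp add: primes_coprime)
  show thesis
  proof (cases "\<exists>k. ord x = p ^ k")
    case True
    then have "coprime (ord x) q"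
      using cop by (auto simp: coprime_commute)
    moreover have "d \<noteq> \<one>"
      using d \<open>prime q\<close> by auto
    ultimately show thesis
      using that[OF dG(1)] cyclic_group_generated_coprime_ord[OF x dG(1) dG(2)[OF x]]
        cyclic_group_generated_coprime_ord[OF dG(1) cG(1) cG(2)[OF dG(1)]] cop c(2) d(2)
      by blast
  next
    case False
    have pos: "ord x > 0"
      using ord_ge_1[OF fin x] by simp
    then obtain r where r: "prime r" "r \<noteq> p" "r dvd ord x"
      using exists_other_prime_divisor[of "ord x" p] False by blast
    \<comment> \<open>The exponent is chosen so that \<open>w\<close> has order exactly
      \<open>r\<close>, which is coprime to \<open>ord c\<close>.\<close>
    define w where "w = x [^] (ord x div r)"
    have wG: "w \<in> carrier G"
      using x by (simp add: w_def)
    have "ord w = ord x div (ord x div r)"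
      unfolding w_def using r pos x
      by (intro ord_pow) (auto simp: dvd_div_eq_0_iff div_dvd_iff_mult)
    also have "\<dots> = r"
      using r pos by (auto elim!: dvdE)
    finally have ord_w: "ord w = r" .
    moreover have "w \<noteq> \<one>"
      using ord_w r by auto
    moreover have "coprime r p"
      using r \<open>prime p\<close> by (simp add: primes_coprime)
    moreover have "cyclic_group (subgroup_generated G {x, w})"
      unfolding w_def using x by (rule cyclic_group_generated_pow)
    ultimately show thesis
      using that[OF wG] cyclic_group_generated_coprime_ord[OF wG cG(1) cG(2)[OF wG]] c(2)
      by blast
  qed
qed

section \<open>Walks between orbits\<close>

lemma (in group) mem_aut_orbit_self:
  assumes "subgroup A (AutoGroup G)" and "x \<in> carrier G"
  shows "x \<in> aut_orbit G A x"
proof -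
  \<comment> \<open>The unit of \<open>AutoGroup G\<close> is the identity restricted to the
    carrier, since its elements are extensional functions.\<close>
  have "(\<lambda>g\<in>carrier G. g) \<in> A"
    using subgroup.one_closed[OF assms(1)] by (simp add: AutoGroup_def BijGroup_def)
  then show ?thesis
    using assms(2) unfolding aut_orbit_eq by (intro CollectI exI[of _ "\<lambda>g\<in>carrier G. g"]) simp
qed

text \<open>The bound is at most 1 rather than adjacency because \<open>x\<close> and
  \<open>y\<close> may share an orbit; the empty walk then serves.\<close>

lemma (in group) short_walk_if_cyclic:
  assumes fin: "finite (carrier G)" and A: "subgroup A (AutoGroup G)"
    and x: "x \<in> carrier G" "x \<noteq> \<one>" and y: "y \<in> carrier G" "y \<noteq> \<one>"
    and cyc: "cyclic_group (subgroup_generated G {x, y})"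
  shows "\<exists>w. pre_digraph.awalk (aut_cyclic_graph G A) (aut_orbit G A x) w (aut_orbit G A y)
    \<and> length w \<le> 1"
proof -
  interpret D: graph "aut_cyclic_graph G A"
    using fin by (rule graph_aut_cyclic_graph)
  let ?X = "aut_orbit G A x" and ?Y = "aut_orbit G A y"
  have verts: "?X \<in> verts (aut_cyclic_graph G A)" "?Y \<in> verts (aut_cyclic_graph G A)"
    using x y by (auto simp: aut_cyclic_graph_def aut_cyclic_verts_def)
  show ?thesis
  proof (cases "?X = ?Y")
    case True
    then show ?thesis
      using verts by (intro exI[of _ "[]"]) (simp add: D.awalk_Nil_iff)
  next
    case False
    then have "(?X, ?Y) \<in> arcs (aut_cyclic_graph G A)"
      using verts cyc mem_aut_orbit_self[OF A] x y by (auto simp: aut_cyclic_graph_def)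
    then have "D.awalk ?X [(?X, ?Y)] ?Y"
      using verts by (simp add: D.awalk_Cons_iff D.awalk_Nil_iff)
        (simp add: aut_cyclic_graph_def)
    then show ?thesis
      by (intro exI[of _ "[(?X, ?Y)]"]) simp
  qed
qed

theorem theorem1:
  fixes G :: "('a, 'b) monoid_scheme" and A :: "('a \<Rightarrow> 'a) set"
  assumes "group G"
    and "finite (carrier G)"
    and "subgroup A (AutoGroup G)"
    and "\<And>p :: nat. prime p \<Longrightarrow> \<not> is_p_group p (G\<lparr>carrier := center G\<rparr>)"
  shows "Digraph_Component.connected (aut_cyclic_graph G A) \<and>
         graph_diameter (aut_cyclic_graph G A) \<le> 4"
proof -
  interpret group G by fact
  let ?D = "aut_cyclic_graph G A"
  interpret D: graph ?D
    using assms(2) by (rule graph_aut_cyclic_graph)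
  have "group (G\<lparr>carrier := center G\<rparr>)"
    by (rule subgroup_imp_group[OF center_subgroup])
  then have not_power: "card (center G) \<noteq> p ^ k" if "prime p" for p k
    using assms(4)[OF that] by (auto simp: is_p_group_def order_def)
  have "finite (center G)" "center G \<noteq> {}"
    using assms(2) subgroup.one_closed[OF center_subgroup] by (auto simp: center_def)
  then have pos: "card (center G) > 0"
    by (simp add: card_gt_0_iff)
  \<comment> \<open>A trivial center would be a 2-group, of order \<open>2 ^ 0\<close>.\<close>
  have "card (center G) \<noteq> 1"
    using not_power[of 2 0] by simp
  then obtain p where p: "prime p" "p dvd card (center G)"
    using prime_factor_nat by blast
  obtain q where q: "prime q" "q \<noteq> p" "q dvd card (center G)"
    using exists_other_prime_divisor[OF pos not_power[OF p(1)]] by blast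
  obtain c where c: "c \<in> center G" "ord c = p"
    using center_cauchy[OF assms(2) p] .
  obtain d where d: "d \<in> center G" "ord d = q"
    using center_cauchy[OF assms(2) q(1,3)] .
  have c': "c \<in> carrier G" "c \<noteq> \<one>\<^bsub>G\<^esub>"
    using c p ord_id by (auto simp: center_def)
  note link = cyclic_link_to_central_element[OF assms(2) p(1) q(1) q(2)[symmetric] c d]
  note step = short_walk_if_cyclic[OF assms(2,3)]
  have walk: "\<exists>w. D.awalk X w Y \<and> length w \<le> 4" if XY: "X \<in> verts ?D" "Y \<in> verts ?D" for X Y
  proof -
    obtain x y where x: "x \<in> carrier G" "x \<noteq> \<one>\<^bsub>G\<^esub>" "X = aut_orbit G A x"
      and y: "y \<in> carrier G" "y \<noteq> \<one>\<^bsub>G\<^esub>" "Y = aut_orbit G A y"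
      using XY by (auto simp: aut_cyclic_graph_def aut_cyclic_verts_def)
    obtain a where a: "a \<in> carrier G" "a \<noteq> \<one>\<^bsub>G\<^esub>"
      "cyclic_group (subgroup_generated G {x, a})" "cyclic_group (subgroup_generated G {a, c})"
      using link[OF x(1)] .
    obtain b where b: "b \<in> carrier G" "b \<noteq> \<one>\<^bsub>G\<^esub>"
      "cyclic_group (subgroup_generated G {y, b})" "cyclic_group (subgroup_generated G {b, c})"
      using link[OF y(1)] .
    then have b': "cyclic_group (subgroup_generated G {c, b})"
      "cyclic_group (subgroup_generated G {b, y})"
      by (simp_all add: insert_commute)
    \<comment> \<open>The walk passes through the orbits of \<open>x\<close>, \<open>a\<close>,
      \<open>c\<close>, \<open>b\<close>, \<open>y\<close>; each of its four pieces has length 0 or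
      1.\<close>
    obtain w1 w2 w3 w4 where
      "D.awalk X w1 (aut_orbit G A a)" "D.awalk (aut_orbit G A a) w2 (aut_orbit G A c)"
      "D.awalk (aut_orbit G A c) w3 (aut_orbit G A b)" "D.awalk (aut_orbit G A b) w4 Y"
      and "length w1 \<le> 1" "length w2 \<le> 1" "length w3 \<le> 1" "length w4 \<le> 1"
      using step[OF x(1,2) a(1-3)] step[OF a(1,2) c' a(4)]
        step[OF c' b(1,2) b'(1)] step[OF b(1,2) y(1,2) b'(2)] x(3) y(3) by blast
    then show ?thesis
      by (intro exI[of _ "w1 @ w2 @ w3 @ w4"]) (auto intro!: D.awalk_appendI)
  qed
  \<comment> \<open>Connectedness includes that the vertex set is nonempty.\<close>
  have "aut_orbit G A c \<in> verts ?D"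
    using c' by (auto simp: aut_cyclic_graph_def aut_cyclic_verts_def)
  moreover have "X \<rightarrow>\<^sup>*\<^bsub>?D\<^esub> Y" if "X \<in> verts ?D" "Y \<in> verts ?D" for X Y
    using walk[OF that] by (auto simp: D.reachable_awalk)
  \<comment> \<open>\<open>connected\<close> means strong connectedness of the symmetric closure,
    where reachability is the same because \<open>?D\<close> is symmetric.\<close>
  ultimately have "Digraph_Component.connected ?D"
    unfolding connected_def by (intro strongly_connectedI)
      (auto simp: D.reachable_mk_symmetric_eq[OF D.sym_arcs])
  moreover have "D.\<mu> (\<lambda>_. 1) X Y \<le> 4" if XY: "X \<in> verts ?D" "Y \<in> verts ?D" for X Y
  proof -
    obtain w where w: "D.awalk X w Y" "length w \<le> 4"
      using walk[OF XY] by blast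
    \<comment> \<open>With unit weights cost is length, so this walk bounds the infimum defining the
      distance.\<close>
    have "D.awalk_cost (\<lambda>_. 1) w = real (length w)"
      by (simp add: D.awalk_cost_def sum_list_triv)
    then show ?thesis
      using D.min_cost_le_walk_cost[OF w(1), of "\<lambda>_. 1"] w(2)
      by (simp add: order_trans)
  qed
  ultimately show ?thesis
    by (auto simp: graph_diameter_def intro!: SUP_least)
qed

end
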